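(* Let $n\ge 2$, let $T=\langle S,s^0,Y,O,\mathrm{ls},L,\Delta\rangle$ be a deterministic and communication-closed transition system, and let $Y=\bigcup_{k=1}^n Y_k$ and $O=\bigcup_{k=1}^n O_k$ with $Y_j\cap Y_k=\emptyset$ and $O_j\cap O_k=\emptyset$ for $j\ne k$. Let $T_1,\dots,T_n$ be the trivial decomposition of $T$ with respect to the interfaces $\langle Y_k,O_k\rangle$. For each $k$, let $[T_k]^{\mathcal C_k}$ be the compression of $T_k$ with respect to the parameter $\mathcal C_k$ given by the rest of the system (the composition of all $T_j$ with $j\neq k$, represented as a single TS). Then $$T_1\|\cdots\|T_n\ \sim\ [T_1]^{\mathcal C_1}\|\cdots\|[T_n]^{\mathcal C_n},$$ where $\sim$ is strong bisimilarity interpreted under the initiated transitions, i.e. transitions on channels in $Y_1\cup\dots\cup Y_n$ that are initiated by one of the components.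
   Context: **Transition systems.** Fix a global set of channels $C$. A transition system (TS) is a tuple $T=\langle S,s_0,Y,O,\mathrm{ls},L,\Delta\rangle$: $S$ is a set of states, $s_0\in S$ the initial state; $Y\subseteq C$ is the set of channels on which $T$ can initiate (on channels in $C\setminus Y$ it can only react); $O$ is an output alphabet; $\langle Y,O\rangle$ is the interface; $\mathrm{ls}:S\to 2^{C}$ is the listening function; $L:S\to 2^{Y}\times 2^{O}$, $L(s)=(L^c(s),L^o(s))$, is the labelling; $\Delta\subseteq S\times C\times S$, with $\Delta(s,c)=\{s'\mid (s,c,s')\in\Delta\}$. It is required that (i) $\Delta(s,c)\ne\emptyset$ iff $c\in \mathrm{ls}(s)$; (ii) if $c\in Y$ and $s'\in\Delta(s,c)$ then $c\in L^c(s')$. $T$ is communication-closed if $\Delta\subseteq S\times Y\times S$, and deterministic if $|\Delta(s,c)|\le 1$ for all $s,c$. Write $s\xrightarrow{c}_! s'$ iff $c\in Y$, $(s,c,s')\in\Delta$ and $c\in L^c(s')$; write $s\xrightarrow{c}_? s'$ iff $c\in C\setminus Y$, $c\in\mathrm{ls}(s)$ and $(s,c,s')\in\Delta$. **Composition.** $T_1\|T_2$ has states $S_1\times S_2$, initial state $(s_1^0,s_2^0)$, interface $\langle Y_1\cup Y_2,O_1\cup O_2\rangle$, $\mathrm{ls}((s_1,s_2))=\mathrm{ls}_1(s_1)\cup\mathrm{ls}_2(s_2)$, $L((s_1,s_2))=(L_1^c(s_1)\cup L_2^c(s_2),L_1^o(s_1)\cup L_2^o(s_2))$, and $((s_1,s_2),c,(s_1',s_2'))\in\Delta$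 iff one of: (a) $c\in Y_1$, $(s_1,c,s_1')\in\Delta_1$ and either [$c\in\mathrm{ls}_2(s_2)$ and $(s_2,c,s_2')\in\Delta_2$] or [$c\notin\mathrm{ls}_2(s_2)$ and $s_2'=s_2$]; (b) the same with roles of 1 and 2 exchanged; (c) $c\notin Y_1\cup Y_2$ and either both $c\in \mathrm{ls}_i(s_i)$ and $(s_i,c,s_i')\in\Delta_i$ for $i=1,2$, or $c\in\mathrm{ls}_1(s_1)\setminus\mathrm{ls}_2(s_2)$, $(s_1,c,s_1')\in\Delta_1$, $s_2'=s_2$, or $c\in\mathrm{ls}_2(s_2)\setminus\mathrm{ls}_1(s_1)$, $(s_2,c,s_2')\in\Delta_2$, $s_1'=s_1$. Compositions of several TSs are obtained by iterating $\|$. **Strong bisimilarity.** A strong bisimulation on a TS is a symmetric relation $R$ on states such that $(s_1,s_2)\in R$ implies $L(s_1)=L(s_2)$ and, for all $c\in C$: $s_1\xrightarrow{c}_! s_1'$ implies $s_2\xrightarrow{c}_! s_2'$ for some $s_2'$ with $(s_1',s_2')\in R$; and $s_1\xrightarrow{c}_? s_1'$ implies $s_2\xrightarrow{c}_? s_2'$ for some $s_2'$ with $(s_1',s_2')\in R$. Two TSs are strongly bisimilar ($\sim$) iff their initial states are related by some strong bisimulation on the disjoint union. "Interpreted under initiated transitions" means only the label condition and the condition on $\xrightarrow{c}_!$ are required. **Trivial decomposition.** For a deterministic and communication-closed TS $T=\langle S,s^0,Y,O,\mathrm{ls},L,\Delta\rangle$ and interfaces $\langle Y_k,O_k\rangle$,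 $k=1,\dots,n$, with $Y=\bigcup_k Y_k$ and $O=\bigcup_k O_k$ both disjoint unions, $T_k=\langle S,s^0,Y_k,O_k,\mathrm{ls},L_k,\Delta\rangle$ with $L_k(s)=(L^c(s)\cap Y_k,\,L^o(s)\cap O_k)$. The parameter for $T_k$ is the TS $\mathcal C_k$ obtained in the same way from $T$ with the interface $\langle \bigcup_{j\ne k}Y_j,\bigcup_{j\neq k}O_j\rangle$. The state set of the parameter is denoted $\mathcal E$ (a copy of $S$), and $\mathbf f:S\to\mathcal E$ is the canonical bijection, sending each state to its copy. **Reconfigurable bisimulation.** Fix $k$. Let $T_k=\langle S,s^0,Y_k,O_k,\mathrm{ls},L_k,\Delta\rangle$ be the $k$-th component of the trivial decomposition of $T$; write $Y_T=Y_k$ for its initiate channels and $L$ for its labelling $L_k$. Let $\mathcal C=\mathcal C_k$ be the parameter for $T_k$, i.e. the copy of $T$ with state set $\mathcal E=\mathbf f(S)$, initiate channels $Y_{\mathcal C}=\bigcup_{j\ne k}Y_j$, outputs $\bigcup_{j\ne k}O_j$, labels of $T$ restricted to this interface, and the transition relation of $T$ carried over along the bijection $\mathbf f:S\to\mathcal E$ and again denoted $\Delta$. An $\mathcal E$-indexed family $\mathcal R=\{\mathcal R_\epsilon\}_{\epsilon\in\mathcal E}$, $\mathcal R_\epsilon\subseteq S\times S$, is a reconfigurable bisimulation if both $\mathcal R$ and $\mathcal R^{-1}=\{\mathcal R_\epsilon^{-1}\}_\epsilon$ satisfy: for every $\epsilon$ and $(s_1,s_2)\in\mathcal R_\epsilon$,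 1. $L(s_1)=L(s_2)$; 2. for all $c\in Y_T\cup Y_{\mathcal C}$: - (2.1) if there is no $\epsilon'$ with $(\epsilon,c,\epsilon')\in\Delta$, then $s_1\xrightarrow{c}_! s_1'$ implies there is $s_2'$ with $s_2\xrightarrow{c}_! s_2'$ and $(s_1',s_2')\in\mathcal R_\epsilon$; - (2.2) if $(\epsilon,c,\epsilon')\in\Delta$ for some $\epsilon'$, then (a) $s_1\xrightarrow{c}_! s_1'$ implies there is $s_2'$ with $s_2\xrightarrow{c}_! s_2'$ and $(s_1',s_2')\in\mathcal R_{\epsilon'}$; and (b) $s_1\xrightarrow{c}_? s_1'$ implies either (i) $c\in\mathrm{ls}(s_2)$ and there is $s_2'$ with $s_2\xrightarrow{c}_? s_2'$ and $(s_1',s_2')\in\mathcal R_{\epsilon'}$, or (ii) $c\notin\mathrm{ls}(s_2)$ and [$(s_1',s_2)\notin\mathcal R_\epsilon$ implies $(s_1',\mathbf f^{-1}(\epsilon'))\in\mathcal R_{\epsilon'}$]. Write $s_1\sim_\epsilon s_2$ iff $(s_1,s_2)\in\mathcal R_\epsilon$ for some reconfigurable bisimulation $\mathcal R$, and $[s]^{\sim_\epsilon}=\{s'\mid s\sim_\epsilon s'\}$. **Compression.** For $s\in S$ let $C_s=\{s'\mid s'\in[s]^{\sim_{\mathbf f(s)}}\text{ and } s\in[s']^{\sim_{\mathbf f(s')}}\}$. Let $G$ be the graph on $S$ with an edge $\{s,s'\}$ iff $s'\in C_s$ and $s\in C_{s'}$. Let $\mathcal P^{\mathrm{nd}}$ be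 a partition of $S$ into cliques of $G$ that is maximal, i.e. no two distinct blocks have a union that is a clique. Let $\mathcal P$ be obtained from $\mathcal P^{\mathrm{nd}}$ by Paige–Tarjan style refinement: as long as some block $B$ contains states $s_1,s_2$ with $(s_1,c,s_1'),(s_2,c,s_2')\in\Delta$ for the same $c$ and $s_1',s_2'$ in different blocks $B'$, $B''$, split $B$ into the states having a $c$-transition into $B'$ and the rest. The compressed TS $[T_k]^{\mathcal C}$ has as states the blocks of $\mathcal P$, as initial state the block containing $s^0$, the interface of $T_k$, label $L(B)=L_k(s)$ for any $s\in B$, transitions $$\{(B,c,B')\mid B\ne B',\ \exists s\in B,s'\in B',\ (s,c,s')\in\Delta\}\ \cup\ \{(B,c,B)\mid c\in Y_k,\ \forall s\in B\,\exists s'\in B,\ (s,c,s')\in\Delta\},$$ and $\mathrm{ls}(B)=\{c\mid (B,c,B')\text{ is a transition for some }B'\}$. *)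

theory Defs
  imports Main "HOL-Library.Disjoint_Sets"
begin

section \<open>Transition systems\<close>

text \<open>The global set of channels is the type \<open>'c\<close>. The fields of a transition system are its
  states, initial state, initiate channels, output alphabet, listening function, labelling
  and transition relation; the functions are only relevant on the state set.\<close>

record ('s, 'c, 'o) ts =
  states :: "'s set"
  start :: 's
  chans :: "'c set"
  outs :: "'o set"
  ls :: "'s \<Rightarrow> 'c set"
  lab :: "'s \<Rightarrow> 'c set \<times> 'o set"
  trn :: "('s \<times> 'c \<times> 's) set"

definition succs :: "('s, 'c, 'o) ts \<Rightarrow> 's \<Rightarrow> 'c \<Rightarrow> 's set" where
  "succs T s c = {s'. (s, c, s') \<in> trn T}"

definition transition_system :: "('s, 'c, 'o) ts \<Rightarrow> bool" where
  "transition_system T \<longleftrightarrow>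
     start T \<in> states T \<and>
     (\<forall>s\<in>states T. fst (lab T s) \<subseteq> chans T \<and> snd (lab T s) \<subseteq> outs T) \<and>
     trn T \<subseteq> states T \<times> UNIV \<times> states T \<and>
     (\<forall>s\<in>states T. \<forall>c. succs T s c \<noteq> {} \<longleftrightarrow> c \<in> ls T s) \<and>
     (\<forall>s\<in>states T. \<forall>c\<in>chans T. \<forall>s'\<in>succs T s c. c \<in> fst (lab T s'))"

definition communication_closed :: "('s, 'c, 'o) ts \<Rightarrow> bool" where
  "communication_closed T \<longleftrightarrow> trn T \<subseteq> states T \<times> chans T \<times> states T"

text \<open>At most one successor; \<open>card\<close> is avoided because it is \<open>0\<close> on infinite sets.\<close>

definition deterministic :: "('s, 'c, 'o) ts \<Rightarrow> bool" where
  "deterministic T \<longleftrightarrow>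
     (\<forall>s\<in>states T. \<forall>c. \<forall>s'\<in>succs T s c. \<forall>s''\<in>succs T s c. s' = s'')"

definition initiates :: "('s, 'c, 'o) ts \<Rightarrow> 's \<Rightarrow> 'c \<Rightarrow> 's \<Rightarrow> bool" where
  "initiates T s c s' \<longleftrightarrow> c \<in> chans T \<and> (s, c, s') \<in> trn T \<and> c \<in> fst (lab T s')"

definition reacts :: "('s, 'c, 'o) ts \<Rightarrow> 's \<Rightarrow> 'c \<Rightarrow> 's \<Rightarrow> bool" where
  "reacts T s c s' \<longleftrightarrow> c \<notin> chans T \<and> c \<in> ls T s \<and> (s, c, s') \<in> trn T"

text \<open>The isomorphic copy of \<open>T\<close> along a map \<open>f\<close> that is injective on the states of \<open>T\<close>.\<close>

definition rename :: "('s \<Rightarrow> 't) \<Rightarrow> ('s, 'c, 'o) ts \<Rightarrow> ('t, 'c, 'o) ts" where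
  "rename f T = \<lparr>
     states = f ` states T,
     start = f (start T),
     chans = chans T,
     outs = outs T,
     ls = (\<lambda>t. ls T (inv_into (states T) f t)),
     lab = (\<lambda>t. lab T (inv_into (states T) f t)),
     trn = {(f s, c, f s') | s c s'. (s, c, s') \<in> trn T} \<rparr>"


section \<open>Composition\<close>

definition par :: "('a, 'c, 'o) ts \<Rightarrow> ('b, 'c, 'o) ts \<Rightarrow> ('a \<times> 'b, 'c, 'o) ts"
    (infixl \<open>\<parallel>\<close> 60) where
  "A \<parallel> B = \<lparr>
     states = states A \<times> states B,
     start = (start A, start B),
     chans = chans A \<union> chans B,
     outs = outs A \<union> outs B,
     ls = (\<lambda>(a, b). ls A a \<union> ls B b),
     lab = (\<lambda>(a, b). (fst (lab A a) \<union> fst (lab B b), snd (lab A a) \<union> snd (lab B b))),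
     trn = {((a, b), c, (a', b')) | a b c a' b'.
       a \<in> states A \<and> b \<in> states B \<and> a' \<in> states A \<and> b' \<in> states B \<and>
       ((c \<in> chans A \<and> (a, c, a') \<in> trn A \<and>
           ((c \<in> ls B b \<and> (b, c, b') \<in> trn B) \<or> (c \<notin> ls B b \<and> b' = b))) \<or>
        (c \<in> chans B \<and> (b, c, b') \<in> trn B \<and>
           ((c \<in> ls A a \<and> (a, c, a') \<in> trn A) \<or> (c \<notin> ls A a \<and> a' = a))) \<or>
        (c \<notin> chans A \<union> chans B \<and>
           ((c \<in> ls A a \<and> (a, c, a') \<in> trn A \<and> c \<in> ls B b \<and> (b, c, b') \<in> trn B) \<or>
            (c \<in> ls A a - ls B b \<and> (a, c, a') \<in> trn A \<and> b' = b) \<or>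
            (c \<in> ls B b - ls A a \<and> (b, c, b') \<in> trn B \<and> a' = a))))} \<rparr>"

text \<open>The iterated composition \<open>(\<dots>(T\<^sub>1 \<parallel> T\<^sub>2) \<parallel> \<dots>) \<parallel> T\<^sub>n\<close> of a nonempty list of systems. Since the
  nested product type would depend on \<open>n\<close>, the tuple \<open>((s\<^sub>1, s\<^sub>2), \<dots>, s\<^sub>n)\<close> is represented by the
  list \<open>[s\<^sub>1, \<dots>, s\<^sub>n]\<close>.\<close>

definition par_list :: "('s, 'c, 'o) ts list \<Rightarrow> ('s list, 'c, 'o) ts" where
  "par_list Ts =
     foldl (\<lambda>A B. rename (\<lambda>(ss, s). ss @ [s]) (A \<parallel> B)) (rename (\<lambda>s. [s]) (hd Ts)) (tl Ts)"


section \<open>Strong bisimilarity under initiated transitions\<close>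

definition initiated_bisimulation :: "('s, 'c, 'o) ts \<Rightarrow> ('s \<times> 's) set \<Rightarrow> bool" where
  "initiated_bisimulation T R \<longleftrightarrow>
     R \<subseteq> states T \<times> states T \<and> sym R \<and>
     (\<forall>(s1, s2)\<in>R. lab T s1 = lab T s2 \<and>
        (\<forall>c s1'. initiates T s1 c s1' \<longrightarrow> (\<exists>s2'. initiates T s2 c s2' \<and> (s1', s2') \<in> R)))"

text \<open>The initial state of the disjoint union plays no role for bisimulations.\<close>

definition disjoint_union :: "('a, 'c, 'o) ts \<Rightarrow> ('b, 'c, 'o) ts \<Rightarrow> ('a + 'b, 'c, 'o) ts" where
  "disjoint_union A B = \<lparr>
     states = states A <+> states B,
     start = Inl (start A),
     chans = chans A \<union> chans B,
     outs = outs A \<union> outs B,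
     ls = case_sum (ls A) (ls B),
     lab = case_sum (lab A) (lab B),
     trn = {(Inl a, c, Inl a') | a c a'. (a, c, a') \<in> trn A} \<union>
           {(Inr b, c, Inr b') | b c b'. (b, c, b') \<in> trn B} \<rparr>"

definition initiated_bisimilar :: "('a, 'c, 'o) ts \<Rightarrow> ('b, 'c, 'o) ts \<Rightarrow> bool" where
  "initiated_bisimilar A B \<longleftrightarrow>
     (\<exists>R. initiated_bisimulation (disjoint_union A B) R \<and> (Inl (start A), Inr (start B)) \<in> R)"


section \<open>Trivial decomposition\<close>

definition restrict_interface ::
    "('s, 'c, 'o) ts \<Rightarrow> 'c set \<Rightarrow> 'o set \<Rightarrow> ('s, 'c, 'o) ts" where
  "restrict_interface T Y' O' = \<lparr>
     states = states T,
     start = start T,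
     chans = Y',
     outs = O',
     ls = ls T,
     lab = (\<lambda>s. (fst (lab T s) \<inter> Y', snd (lab T s) \<inter> O')),
     trn = trn T \<rparr>"

definition component ::
    "('s, 'c, 'o) ts \<Rightarrow> (nat \<Rightarrow> 'c set) \<Rightarrow> (nat \<Rightarrow> 'o set) \<Rightarrow> nat \<Rightarrow> ('s, 'c, 'o) ts" where
  "component T Y Out k = restrict_interface T (Y k) (Out k)"

text \<open>The parameter has its own copy of the states, and the constructor \<open>Copy\<close> is the
  canonical bijection \<open>\<^bold>f\<close>.\<close>

datatype 's copy = Copy (uncopy: 's)

definition parameter ::
    "('s, 'c, 'o) ts \<Rightarrow> nat \<Rightarrow> (nat \<Rightarrow> 'c set) \<Rightarrow> (nat \<Rightarrow> 'o set) \<Rightarrow> nat \<Rightarrow> ('s copy, 'c, 'o) ts"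
  where
  "parameter T n Y Out k =
     rename Copy (restrict_interface T (\<Union>j\<in>{1..n} - {k}. Y j) (\<Union>j\<in>{1..n} - {k}. Out j))"


section \<open>Reconfigurable bisimulation\<close>

definition reconfigurable_simulation ::
    "('s, 'c, 'o) ts \<Rightarrow> ('s copy, 'c, 'o) ts \<Rightarrow> ('s copy \<Rightarrow> ('s \<times> 's) set) \<Rightarrow> bool" where
  "reconfigurable_simulation T E R \<longleftrightarrow>
     (\<forall>\<epsilon>\<in>states E. \<forall>(s1, s2)\<in>R \<epsilon>.
        lab T s1 = lab T s2 \<and>
        (\<forall>c\<in>chans T \<union> chans E.
           ((\<nexists>\<epsilon>'. (\<epsilon>, c, \<epsilon>') \<in> trn E) \<longrightarrow>
              (\<forall>s1'. initiates T s1 c s1' \<longrightarrow>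
                 (\<exists>s2'. initiates T s2 c s2' \<and> (s1', s2') \<in> R \<epsilon>))) \<and>
           (\<forall>\<epsilon>'. (\<epsilon>, c, \<epsilon>') \<in> trn E \<longrightarrow>
              (\<forall>s1'. initiates T s1 c s1' \<longrightarrow>
                 (\<exists>s2'. initiates T s2 c s2' \<and> (s1', s2') \<in> R \<epsilon>')) \<and>
              (\<forall>s1'. reacts T s1 c s1' \<longrightarrow>
                 (c \<in> ls T s2 \<and> (\<exists>s2'. reacts T s2 c s2' \<and> (s1', s2') \<in> R \<epsilon>')) \<or>
                 (c \<notin> ls T s2 \<and>
                    ((s1', s2) \<notin> R \<epsilon> \<longrightarrow> (s1', uncopy \<epsilon>') \<in> R \<epsilon>'))))))"

definition reconfigurable_bisimulation ::
    "('s, 'c, 'o) ts \<Rightarrow> ('s copy, 'c, 'o) ts \<Rightarrow> ('s copy \<Rightarrow> ('s \<times> 's) set) \<Rightarrow> bool" where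
  "reconfigurable_bisimulation T E R \<longleftrightarrow>
     (\<forall>\<epsilon>\<in>states E. R \<epsilon> \<subseteq> states T \<times> states T) \<and>
     reconfigurable_simulation T E R \<and>
     reconfigurable_simulation T E (\<lambda>\<epsilon>. (R \<epsilon>)\<inverse>)"

definition reconfigurably_bisimilar ::
    "('s, 'c, 'o) ts \<Rightarrow> ('s copy, 'c, 'o) ts \<Rightarrow> 's copy \<Rightarrow> 's \<Rightarrow> 's \<Rightarrow> bool" where
  "reconfigurably_bisimilar T E \<epsilon> s1 s2 \<longleftrightarrow>
     (\<exists>R. reconfigurable_bisimulation T E R \<and> (s1, s2) \<in> R \<epsilon>)"

definition bisim_class ::
    "('s, 'c, 'o) ts \<Rightarrow> ('s copy, 'c, 'o) ts \<Rightarrow> 's copy \<Rightarrow> 's \<Rightarrow> 's set" where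
  "bisim_class T E \<epsilon> s = {s'. reconfigurably_bisimilar T E \<epsilon> s s'}"


section \<open>Compression\<close>

definition mergeable :: "('s, 'c, 'o) ts \<Rightarrow> ('s copy, 'c, 'o) ts \<Rightarrow> 's \<Rightarrow> 's set" where
  "mergeable T E s =
     {s'\<in>states T. s' \<in> bisim_class T E (Copy s) s \<and> s \<in> bisim_class T E (Copy s') s'}"

definition merge_clique :: "('s, 'c, 'o) ts \<Rightarrow> ('s copy, 'c, 'o) ts \<Rightarrow> 's set \<Rightarrow> bool" where
  "merge_clique T E K \<longleftrightarrow>
     K \<subseteq> states T \<and>
     (\<forall>s\<in>K. \<forall>s'\<in>K. s \<noteq> s' \<longrightarrow> s' \<in> mergeable T E s \<and> s \<in> mergeable T E s')"

definition maximal_clique_partition ::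
    "('s, 'c, 'o) ts \<Rightarrow> ('s copy, 'c, 'o) ts \<Rightarrow> 's set set \<Rightarrow> bool" where
  "maximal_clique_partition T E P \<longleftrightarrow>
     partition_on (states T) P \<and>
     (\<forall>B\<in>P. merge_clique T E B) \<and>
     (\<forall>B\<in>P. \<forall>B'\<in>P. B \<noteq> B' \<longrightarrow> \<not> merge_clique T E (B \<union> B'))"

definition split_step :: "('s, 'c, 'o) ts \<Rightarrow> 's set set \<Rightarrow> 's set set \<Rightarrow> bool" where
  "split_step T P P' \<longleftrightarrow>
     (\<exists>B\<in>P. \<exists>B'\<in>P. \<exists>B''\<in>P. \<exists>s1\<in>B. \<exists>s2\<in>B. \<exists>s1'\<in>B'. \<exists>s2'\<in>B''. \<exists>c.
        B' \<noteq> B'' \<and> (s1, c, s1') \<in> trn T \<and> (s2, c, s2') \<in> trn T \<and>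
        P' = (P - {B}) \<union>
             {{s\<in>B. \<exists>t\<in>B'. (s, c, t) \<in> trn T}, {s\<in>B. \<not> (\<exists>t\<in>B'. (s, c, t) \<in> trn T)}})"

text \<open>Neither the maximal clique partition nor the order of the splits is unique, so the
  compression is relative to a partition \<open>P\<close> that arises from some terminating run.\<close>

definition compression_partition ::
    "('s, 'c, 'o) ts \<Rightarrow> ('s copy, 'c, 'o) ts \<Rightarrow> 's set set \<Rightarrow> bool" where
  "compression_partition T E P \<longleftrightarrow>
     (\<exists>Pnd. maximal_clique_partition T E Pnd \<and> (split_step T)\<^sup>*\<^sup>* Pnd P) \<and>
     (\<nexists>P'. split_step T P P')"

definition compressed_trn ::
    "('s, 'c, 'o) ts \<Rightarrow> 's set set \<Rightarrow> ('s set \<times> 'c \<times> 's set) set" where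
  "compressed_trn T P =
     {(B, c, B') | B c B'. B \<in> P \<and> B' \<in> P \<and> B \<noteq> B' \<and> (\<exists>s\<in>B. \<exists>s'\<in>B'. (s, c, s') \<in> trn T)} \<union>
     {(B, c, B) | B c. B \<in> P \<and> c \<in> chans T \<and> (\<forall>s\<in>B. \<exists>s'\<in>B. (s, c, s') \<in> trn T)}"

text \<open>All states of a block have the same label, as blocks lie within cliques; hence the choice
  in the labelling is immaterial.\<close>

definition compressed :: "('s, 'c, 'o) ts \<Rightarrow> 's set set \<Rightarrow> ('s set, 'c, 'o) ts" where
  "compressed T P = \<lparr>
     states = P,
     start = (THE B. B \<in> P \<and> start T \<in> B),
     chans = chans T,
     outs = outs T,
     ls = (\<lambda>B. {c. \<exists>B'. (B, c, B') \<in> compressed_trn T P}),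
     lab = (\<lambda>B. lab T (SOME s. s \<in> B)),
     trn = compressed_trn T P \<rparr>"

end

theory Submission
  imports Defs
begin

text \<open>Both compositions follow \<open>T\<close> in lockstep. From \<open>(s, \<dots>, s)\<close>, respectively from the tuple of
  the blocks containing \<open>s\<close>, the initiated \<open>c\<close>-transitions are exactly those leading to the tuple
  of a \<open>c\<close>-successor \<open>s'\<close> of \<open>s\<close> in \<open>T\<close>. For blocks this has two reasons. A partition that cannot be
  split any more is stable, so the \<open>c\<close>-successor block of \<open>s\<close> depends only on the block of \<open>s\<close>, and a
  component that does not listen to \<open>c\<close> has \<open>s\<close> and \<open>s'\<close> in the same block. And states of one block
  of \<open>T\<^sub>k\<close> are related by \<open>\<sim>\<^bsub>\<^bold>f(s)\<^esub>\<close>, so they enable the same channels in \<open>Y\<^sub>k\<close>.\<close>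

section \<open>Iterated composition\<close>

text \<open>One component's share of a \<open>c\<close>-event, whoever initiates it. It absorbs the
  alternatives of listening or not listening that recur in all cases of the binary rule.\<close>

definition local_step :: "('s, 'c, 'o) ts \<Rightarrow> 'c \<Rightarrow> 's \<Rightarrow> 's \<Rightarrow> bool" where
  "local_step A c a a' \<longleftrightarrow> (if c \<in> ls A a then (a, c, a') \<in> trn A else a' = a)"

definition listens_to_transitions :: "('s, 'c, 'o) ts \<Rightarrow> bool" where
  "listens_to_transitions A \<longleftrightarrow>
     (\<forall>a c a'. (a, c, a') \<in> trn A \<longrightarrow> a \<in> states A \<and> a' \<in> states A \<and> c \<in> ls A a)"

definition disjoint_chans :: "('s, 'c, 'o) ts list \<Rightarrow> bool" where
  "disjoint_chans Ts \<longleftrightarrow>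
     (\<forall>i<length Ts. \<forall>j<length Ts. i \<noteq> j \<longrightarrow> chans (Ts ! i) \<inter> chans (Ts ! j) = {})"

section \<open>Fields of an iterated composition\<close>

lemma par_list_single: "par_list [A] = rename (\<lambda>s. [s]) A"
  by (simp add: par_list_def)

lemma par_list_snoc:
  "Ts \<noteq> [] \<Longrightarrow> par_list (Ts @ [B]) = rename (\<lambda>(ss, s). ss @ [s]) (par_list Ts \<parallel> B)"
  by (simp add: par_list_def)

lemma rename_at_image:
  assumes "inj_on f (states A)" and "a \<in> states A"
  shows "ls (rename f A) (f a) = ls A a" and "lab (rename f A) (f a) = lab A a"
  using assms by (simp_all add: rename_def)

lemma rename_trn_image:
  assumes "inj f"
  shows "(f a, c, f a') \<in> trn (rename f A) \<longleftrightarrow> (a, c, a') \<in> trn A"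
  using assms by (auto simp: rename_def dest: injD)

lemma inj_snoc: "inj (\<lambda>(ss, s). ss @ [s])"
  by (auto simp: inj_def)

lemma start_par_list: "Ts \<noteq> [] \<Longrightarrow> start (par_list Ts) = map start Ts"
  by (induction Ts rule: rev_nonempty_induct)
     (auto simp: par_list_single par_list_snoc rename_def par_def)

lemma chans_par_list: "Ts \<noteq> [] \<Longrightarrow> chans (par_list Ts) = (\<Union>A\<in>set Ts. chans A)"
  by (induction Ts rule: rev_nonempty_induct)
     (auto simp: par_list_single par_list_snoc rename_def par_def)

lemma states_par_list:
  "Ts \<noteq> [] \<Longrightarrow>
    states (par_list Ts) = {ss. length ss = length Ts \<and> (\<forall>i<length Ts. ss ! i \<in> states (Ts ! i))}"
proof (induction Ts rule: rev_nonempty_induct)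
  case (single A)
  show ?case
    by (auto simp: par_list_single rename_def image_iff length_Suc_conv)
next
  case (snoc B Ts)
  have "ss \<in> states (par_list (Ts @ [B])) \<longleftrightarrow>
      length ss = length (Ts @ [B]) \<and> (\<forall>i<length (Ts @ [B]). ss ! i \<in> states ((Ts @ [B]) ! i))"
    for ss
  proof (cases ss rule: rev_cases)
    case Nil
    then show ?thesis
      using snoc.hyps by (auto simp: par_list_snoc rename_def par_def)
  next
    case (snoc xs x)
    have "ss \<in> states (par_list (Ts @ [B])) \<longleftrightarrow> xs \<in> states (par_list Ts) \<and> x \<in> states B"
      using \<open>Ts \<noteq> []\<close> snoc by (force simp: par_list_snoc rename_def par_def image_iff)
    then show ?thesis
      using snoc by (auto simp: \<open>states (par_list Ts) = _\<close> less_Suc_eq nth_append)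
  qed
  then show ?case by auto
qed

text \<open>\<open>rename\<close> reads \<open>ls\<close> and \<open>lab\<close> through
  \<open>inv_into\<close>, so their values can be computed only at images of genuine states;
  appending is injective, so the preimage is \<open>(xs, x)\<close>.\<close>

lemma par_list_snoc_at:
  assumes "Ts \<noteq> []" and "xs \<in> states (par_list Ts)" and "x \<in> states B"
  shows "ls (par_list (Ts @ [B])) (xs @ [x]) = ls (par_list Ts) xs \<union> ls B x"
    and "lab (par_list (Ts @ [B])) (xs @ [x]) =
      (fst (lab (par_list Ts) xs) \<union> fst (lab B x), snd (lab (par_list Ts) xs) \<union> snd (lab B x))"
proof -
  have "inj_on (\<lambda>(ss, s). ss @ [s]) (states (par_list Ts \<parallel> B))"
    and "(xs, x) \<in> states (par_list Ts \<parallel> B)"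
    using inj_snoc inj_on_subset assms by (blast, simp add: par_def)
  from rename_at_image[OF this] show
    "ls (par_list (Ts @ [B])) (xs @ [x]) = ls (par_list Ts) xs \<union> ls B x"
    "lab (par_list (Ts @ [B])) (xs @ [x]) =
      (fst (lab (par_list Ts) xs) \<union> fst (lab B x), snd (lab (par_list Ts) xs) \<union> snd (lab B x))"
    using assms(1) by (simp_all add: par_list_snoc par_def)
qed

lemma states_par_list_snocE:
  assumes "ss \<in> states (par_list (Ts @ [B]))" and "Ts \<noteq> []"
  obtains xs x where "ss = xs @ [x]" "xs \<in> states (par_list Ts)" "x \<in> states B"
    "length xs = length Ts"
proof -
  obtain xs x where "ss = xs @ [x]" "xs \<in> states (par_list Ts)" "x \<in> states B"
    using assms by (auto simp: par_list_snoc rename_def par_def)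
  moreover from this have "length xs = length Ts"
    using states_par_list[OF assms(2)] by simp
  ultimately show thesis using that by blast
qed

lemma ls_lab_par_list:
  assumes "Ts \<noteq> []" and "ss \<in> states (par_list Ts)"
  shows "ls (par_list Ts) ss = (\<Union>i<length Ts. ls (Ts ! i) (ss ! i)) \<and>
    lab (par_list Ts) ss =
      (\<Union>i<length Ts. fst (lab (Ts ! i) (ss ! i)), \<Union>i<length Ts. snd (lab (Ts ! i) (ss ! i)))"
  using assms
proof (induction Ts arbitrary: ss rule: rev_nonempty_induct)
  case (single A)
  then obtain a where a: "a \<in> states A" "ss = [a]"
    by (auto simp: par_list_single rename_def)
  have "inj_on (\<lambda>s. [s]) (states A)" by (simp add: inj_on_def)
  from rename_at_image[OF this a(1)] show ?case
    by (simp add: par_list_single a(2) lessThan_Suc)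
next
  case (snoc B Ts)
  obtain xs x where *: "ss = xs @ [x]" "xs \<in> states (par_list Ts)" "x \<in> states B"
    "length xs = length Ts"
    using snoc.prems snoc.hyps by (rule states_par_list_snocE)
  \<comment> \<open>\<open>F\<close> is generic so that one splitting of the union serves
    \<open>ls\<close> and both halves of \<open>lab\<close>.\<close>
  have un: "(\<Union>i<length (Ts @ [B]). F ((Ts @ [B]) ! i) ((xs @ [x]) ! i)) =
      (\<Union>i<length Ts. F (Ts ! i) (xs ! i)) \<union> F B x" for F :: "_ \<Rightarrow> _ \<Rightarrow> 'z set"
    using * by (auto simp: lessThan_Suc nth_append split: if_splits)
  then show ?case
    using snoc.IH[OF *(2)] par_list_snoc_at[OF snoc.hyps *(2,3)] *(1)
    by (simp only: un[of ls] un[of "\<lambda>A a. fst (lab A a)"] un[of "\<lambda>A a. snd (lab A a)"]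
        fst_conv snd_conv simp_thms)
qed

text \<open>Induction over the binary rule. By disjointness at most one of the prefix and the last
  system can initiate \<open>c\<close>, so the other merely takes a local step. The existential
  conjunct excludes the idle event in which nobody listens and, on initiate channels, events where
  reactors listen but no initiator does.\<close>

lemma trn_par_list:
  assumes "Ts \<noteq> []" and "disjoint_chans Ts" and "\<forall>A\<in>set Ts. listens_to_transitions A"
  shows "(ss, c, ss') \<in> trn (par_list Ts) \<longleftrightarrow>
    ss \<in> states (par_list Ts) \<and> ss' \<in> states (par_list Ts) \<and>
    (\<forall>i<length Ts. local_step (Ts ! i) c (ss ! i) (ss' ! i)) \<and>
    (\<exists>i<length Ts. c \<in> ls (Ts ! i) (ss ! i) \<and>
      (c \<in> chans (par_list Ts) \<longrightarrow> c \<in> chans (Ts ! i)))"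
  using assms
proof (induction Ts arbitrary: ss ss' rule: rev_nonempty_induct)
  case (single A)
  then show ?case
    by (auto simp: par_list_single rename_def local_step_def listens_to_transitions_def)
next
  case (snoc B Ts)
  let ?A = "par_list Ts"
  have lt: "\<forall>A\<in>set Ts. listens_to_transitions A" and ltB: "listens_to_transitions B"
    using snoc.prems by simp_all
  note dj = snoc.prems(1)[unfolded disjoint_chans_def, rule_format]
  have disj: "disjoint_chans Ts"
    unfolding disjoint_chans_def
  proof (intro allI impI)
    fix i j
    assume "i < length Ts" "j < length Ts" "i \<noteq> j"
    then show "chans (Ts ! i) \<inter> chans (Ts ! j) = {}"
      using dj[of i j] by (simp add: nth_append)
  qed
  have dB: "chans ?A \<inter> chans B = {}"
  proof -
    have "chans (Ts ! i) \<inter> chans B = {}" if "i < length Ts" for i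
      using dj[of i "length Ts"] that by (simp add: nth_append)
    then show ?thesis
      using snoc.hyps by (fastforce simp: chans_par_list in_set_conv_nth)
  qed
  note IH = snoc.IH[OF disj lt]
  show ?case
  proof (cases "ss \<in> states (par_list (Ts @ [B])) \<and> ss' \<in> states (par_list (Ts @ [B]))")
    case False
    then show ?thesis
      using snoc.hyps by (auto simp: par_list_snoc rename_def par_def)
  next
    case True
    obtain xs x where *: "ss = xs @ [x]" "xs \<in> states ?A" "x \<in> states B"
      "length xs = length Ts"
      using True snoc.hyps by (blast elim: states_par_list_snocE)
    obtain xs' x' where **: "ss' = xs' @ [x']" "xs' \<in> states ?A" "x' \<in> states B"
      "length xs' = length Ts"
      using True snoc.hyps by (blast elim: states_par_list_snocE)
    have trn: "(ss, c, ss') \<in> trn (par_list (Ts @ [B])) \<longleftrightarrow>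
        ((xs, x), c, (xs', x')) \<in> trn (?A \<parallel> B)"
      using rename_trn_image[OF inj_snoc, of "(xs, x)" c "(xs', x')"] snoc.hyps
      by (simp add: *(1) **(1) par_list_snoc)
    have chB: "chans (par_list (Ts @ [B])) = chans ?A \<union> chans B"
      using snoc.hyps by (auto simp: chans_par_list)
    have all: "(\<forall>i<length (Ts @ [B]). local_step ((Ts @ [B]) ! i) c (ss ! i) (ss' ! i)) \<longleftrightarrow>
        (\<forall>i<length Ts. local_step (Ts ! i) c (xs ! i) (xs' ! i)) \<and> local_step B c x x'"
      by (auto simp: All_less_Suc *(1,4) **(1,4) nth_append)
    have ex: "(\<exists>i<length (Ts @ [B]). Q ((Ts @ [B]) ! i) (ss ! i)) \<longleftrightarrow>
        (\<exists>i<length Ts. Q (Ts ! i) (xs ! i)) \<or> Q B x" for Q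
      by (simp add: Ex_less_Suc *(1,4) nth_append disj_commute cong: conj_cong)
    have lsA: "c \<in> ls ?A xs \<longleftrightarrow> (\<exists>i<length Ts. c \<in> ls (Ts ! i) (xs ! i))"
      using ls_lab_par_list[OF snoc.hyps *(2)] by auto
    \<comment> \<open>If nobody listens, all local steps are idle; this matches the prefix as a
      whole staying put.\<close>
    have quiet: "(\<forall>i<length Ts. local_step (Ts ! i) c (xs ! i) (xs' ! i)) \<longleftrightarrow> xs' = xs"
      if "c \<notin> ls ?A xs"
      using that * ** by (auto simp: lsA local_step_def intro: nth_equalityI)
    have chi: "i < length Ts \<Longrightarrow> c \<in> chans (Ts ! i) \<Longrightarrow> c \<in> chans ?A" for i
      using snoc.hyps by (auto simp: chans_par_list)
    have trB: "(x, c, x') \<in> trn B \<Longrightarrow> c \<in> ls B x"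
      using ltB by (auto simp: listens_to_transitions_def)
    \<comment> \<open>The three alternatives of the reactive case amount to two local steps with at
      least one side listening.\<close>
    have par: "((xs, x), c, (xs', x')) \<in> trn (?A \<parallel> B) \<longleftrightarrow>
       (c \<in> chans ?A \<and> (xs, c, xs') \<in> trn ?A \<and> local_step B c x x') \<or>
       (c \<in> chans B \<and> (x, c, x') \<in> trn B \<and> local_step ?A c xs xs') \<or>
       (c \<notin> chans ?A \<union> chans B \<and> local_step ?A c xs xs' \<and> local_step B c x x' \<and>
          (c \<in> ls ?A xs \<or> c \<in> ls B x))"
      using *(2,3) **(2,3) by (auto simp: par_def local_step_def)
    let ?all = "\<forall>i<length Ts. local_step (Ts ! i) c (xs ! i) (xs' ! i)"
    have trA: "(xs, c, xs') \<in> trn ?A \<longleftrightarrow> ?all \<and>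
        (\<exists>i<length Ts. c \<in> ls (Ts ! i) (xs ! i) \<and> (c \<in> chans ?A \<longrightarrow> c \<in> chans (Ts ! i)))"
      using IH *(2) **(2) by blast
    \<comment> \<open>The restriction on \<open>c\<close> matters: on an initiate channel of the
      prefix a reactor alone may listen. Then the prefix listens without having a transition,
      although its components could each take a local step.\<close>
    have lstA: "local_step ?A c xs xs' \<longleftrightarrow> ?all" if "c \<notin> chans ?A"
      using that trA quiet lsA by (auto simp: local_step_def[of ?A])
    have stB: "local_step B c x x' \<and> c \<in> ls B x \<longleftrightarrow> (x, c, x') \<in> trn B"
      using trB by (auto simp: local_step_def)
    consider "c \<in> chans ?A" "c \<notin> chans B" | "c \<notin> chans ?A" "c \<in> chans B"
      | "c \<notin> chans ?A" "c \<notin> chans B"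
      using dB by blast
    then have "((xs, x), c, (xs', x')) \<in> trn (?A \<parallel> B) \<longleftrightarrow>
        ?all \<and> local_step B c x x' \<and>
        ((\<exists>i<length Ts. c \<in> ls (Ts ! i) (xs ! i) \<and>
            (c \<in> chans ?A \<union> chans B \<longrightarrow> c \<in> chans (Ts ! i))) \<or>
         c \<in> ls B x \<and> (c \<in> chans ?A \<union> chans B \<longrightarrow> c \<in> chans B))"
    proof cases
      case 1
      then show ?thesis unfolding par trA by blast
    next
      case 2
      then show ?thesis unfolding par lstA[OF 2(1)] using stB chi by blast
    next
      case 3
      then show ?thesis unfolding par lstA[OF 3(1)] lsA by blast
    qed
    then show ?thesis
      unfolding trn all chB ex[of "\<lambda>A a. c \<in> ls A a \<and> (c \<in> chans ?A \<union> chans B \<longrightarrow> c \<in> chans A)"]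
      using True by blast
  qed
qed


section \<open>Systems that follow a given system\<close>

text \<open>\<open>f\<close> is a functional bisimulation from \<open>T\<close> for initiated
  transitions. The right-hand side uses \<open>trn T\<close> directly, with communication-closed
  transition systems in mind, where every transition is initiated. States of \<open>A\<close>
  outside the image of \<open>f\<close> are left free, so arbitrary tuples need no
  treatment.\<close>

definition follows :: "('s, 'c, 'o) ts \<Rightarrow> ('a, 'c, 'o) ts \<Rightarrow> ('s \<Rightarrow> 'a) \<Rightarrow> bool" where
  "follows T A f \<longleftrightarrow>
     chans A = chans T \<and> start A = f (start T) \<and>
     (\<forall>s\<in>states T. f s \<in> states A \<and> lab A (f s) = lab T s \<and>
        (\<forall>c a. initiates A (f s) c a \<longleftrightarrow> (\<exists>s'. (s, c, s') \<in> trn T \<and> a = f s')))"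

lemma transition_system_trnD:
  assumes "transition_system T" "(s, c, s') \<in> trn T"
  shows "s \<in> states T" and "s' \<in> states T" and "c \<in> ls T s"
    and "c \<in> chans T \<Longrightarrow> c \<in> fst (lab T s')"
proof -
  show s: "s \<in> states T" and "s' \<in> states T"
    using assms by (auto simp: transition_system_def)
  show "c \<in> ls T s"
    using assms s unfolding transition_system_def succs_def by blast
  show "c \<in> fst (lab T s')" if "c \<in> chans T"
    using assms s that unfolding transition_system_def succs_def by blast
qed

lemma transition_system_lsE:
  assumes "transition_system T" "s \<in> states T" "c \<in> ls T s"
  obtains s' where "(s, c, s') \<in> trn T"
  using assms unfolding transition_system_def succs_def by blast

text \<open>Two functional bisimulations out of the same \<open>T\<close> form a span: pairing the
  two images of each state gives the bisimulation, taken in both orientations to make it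
  symmetric.\<close>

lemma initiated_bisimilar_if_follow:
  assumes "follows T A f" and "follows T B g" and "transition_system T"
  shows "initiated_bisimilar A B"
proof -
  let ?D = "disjoint_union A B"
  define R where "R = (\<lambda>s. (Inl (f s), Inr (g s))) ` states T \<union>
    (\<lambda>s. (Inr (g s), Inl (f s))) ` states T"
  have wf: "\<And>s c s'. (s, c, s') \<in> trn T \<Longrightarrow> s' \<in> states T" and start: "start T \<in> states T"
    using assms(3) by (auto simp: transition_system_def)
  have chans: "chans A = chans T" "chans B = chans T"
    and startAB: "start A = f (start T)" "start B = g (start T)"
    using assms(1,2) by (auto simp: follows_def)
  have f: "f s \<in> states A" "lab A (f s) = lab T s"
    "\<And>c a. initiates A (f s) c a \<longleftrightarrow> (\<exists>s'. (s, c, s') \<in> trn T \<and> a = f s')"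
    and g: "g s \<in> states B" "lab B (g s) = lab T s"
    "\<And>c b. initiates B (g s) c b \<longleftrightarrow> (\<exists>s'. (s, c, s') \<in> trn T \<and> b = g s')"
    if "s \<in> states T" for s
    using assms(1,2) that by (auto simp: follows_def)
  \<comment> \<open>The disjoint union may initiate on \<open>chans A \<union> chans B\<close>; both
    equal \<open>chans T\<close>, so the embedding adds no initiated transitions.\<close>
  have initL: "initiates ?D (Inl a) c x \<longleftrightarrow> (\<exists>a'. x = Inl a' \<and> initiates A a c a')"
    and initR: "initiates ?D (Inr b) c x \<longleftrightarrow> (\<exists>b'. x = Inr b' \<and> initiates B b c b')" for a b c x
    by (auto simp: initiates_def disjoint_union_def chans)
  have labD: "lab ?D (Inl a) = lab A a" "lab ?D (Inr b) = lab B b" for a b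
    by (simp_all add: disjoint_union_def)
  have "lab ?D x = lab ?D y \<and>
      (\<forall>c x'. initiates ?D x c x' \<longrightarrow> (\<exists>y'. initiates ?D y c y' \<and> (x', y') \<in> R))"
    if xy: "(x, y) \<in> R" for x y
  proof -
    from xy consider s where "s \<in> states T" "x = Inl (f s)" "y = Inr (g s)"
      | s where "s \<in> states T" "x = Inr (g s)" "y = Inl (f s)"
      unfolding R_def by blast
    then show ?thesis
    proof cases
      case 1
      have "\<exists>y'. initiates ?D y c y' \<and> (x', y') \<in> R" if step: "initiates ?D x c x'" for c x'
      proof -
        obtain s' where "(s, c, s') \<in> trn T" "x' = Inl (f s')"
          using step 1 by (auto simp: initL f)
        then show ?thesis
          using 1 wf by (intro exI[of _ "Inr (g s')"]) (auto simp: initR g R_def)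
      qed
      then show ?thesis
        using 1 by (auto simp: labD f g)
    next
      case 2
      have "\<exists>y'. initiates ?D y c y' \<and> (x', y') \<in> R" if step: "initiates ?D x c x'" for c x'
      proof -
        obtain s' where "(s, c, s') \<in> trn T" "x' = Inr (g s')"
          using step 2 by (auto simp: initR g)
        then show ?thesis
          using 2 wf by (intro exI[of _ "Inl (f s')"]) (auto simp: initL f R_def)
      qed
      then show ?thesis
        using 2 by (auto simp: labD f g)
    qed
  qed
  moreover have "R \<subseteq> states ?D \<times> states ?D"
    using f(1) g(1) by (auto simp: R_def disjoint_union_def)
  moreover have "sym R"
    by (auto simp: sym_def R_def)
  moreover have "(Inl (start A), Inr (start B)) \<in> R"
    using start startAB by (auto simp: R_def)
  ultimately show ?thesis
    unfolding initiated_bisimilar_def initiated_bisimulation_def by blast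
qed

text \<open>The share of \<open>follows\<close> that can be checked on one component. The last
  clause also covers channels that the component does not initiate: there it may be deaf to
  \<open>c\<close>, but then \<open>f s = f s'\<close> is forced. Exact listening is demanded only
  on its own channels, where it has to act as initiator.\<close>

definition follows_locally :: "('s, 'c, 'o) ts \<Rightarrow> ('a, 'c, 'o) ts \<Rightarrow> ('s \<Rightarrow> 'a) \<Rightarrow> bool" where
  "follows_locally T A f \<longleftrightarrow>
     listens_to_transitions A \<and> start A = f (start T) \<and>
     (\<forall>s\<in>states T. f s \<in> states A \<and>
        lab A (f s) = (fst (lab T s) \<inter> chans A, snd (lab T s) \<inter> outs A) \<and>
        (\<forall>c\<in>chans A. c \<in> ls A (f s) \<longleftrightarrow> c \<in> ls T s) \<and>
        (\<forall>c s' a. (s, c, s') \<in> trn T \<longrightarrow> (local_step A c (f s) a \<longleftrightarrow> a = f s')))"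

text \<open>Communication closure gives every step of \<open>T\<close> an owner, which listens and
  so supplies the initiator; the local clauses then force each component into the image of the
  target. Conversely, an initiated event has a listening owner, so \<open>T\<close> itself enables
  \<open>c\<close>, and the same clauses identify the target tuple.\<close>

lemma par_list_follows:
  fixes T :: "('s, 'c, 'o) ts" and Ts :: "('a, 'c, 'o) ts list"
  assumes T: "transition_system T" "communication_closed T"
    and ne: "Ts \<noteq> []"
    and disj: "disjoint_chans Ts"
    and chans: "chans T = (\<Union>A\<in>set Ts. chans A)"
    and outs: "outs T = (\<Union>A\<in>set Ts. outs A)"
    and loc: "\<And>i. i < length Ts \<Longrightarrow> follows_locally T (Ts ! i) (f i)"
  shows "follows T (par_list Ts) (\<lambda>s. map (\<lambda>i. f i s) [0..<length Ts])"
proof -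
  let ?h = "\<lambda>s. map (\<lambda>i. f i s) [0..<length Ts]"
  let ?A = "par_list Ts"
  have lt: "\<forall>A\<in>set Ts. listens_to_transitions A"
    using loc by (auto simp: in_set_conv_nth follows_locally_def)
  have chA: "chans ?A = chans T"
    using ne by (simp add: chans chans_par_list)
  have sets: "(\<Union>A\<in>set Ts. F A) = (\<Union>i<length Ts. F (Ts ! i))" for F :: "_ \<Rightarrow> 'z set"
    by (auto simp: in_set_conv_nth) (metis nth_mem)
  have "start ?A = ?h (start T)"
    using loc ne by (auto simp: start_par_list follows_locally_def intro: nth_equalityI)
  moreover have "?h s \<in> states ?A \<and> lab ?A (?h s) = lab T s \<and>
      (\<forall>c a. initiates ?A (?h s) c a \<longleftrightarrow> (\<exists>s'. (s, c, s') \<in> trn T \<and> a = ?h s'))"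
    if s: "s \<in> states T" for s
  proof -
    have h: "?h t \<in> states ?A" if "t \<in> states T" for t
      using loc ne that by (simp add: states_par_list follows_locally_def)
    have lab: "lab ?A (?h t) = lab T t" if t: "t \<in> states T" for t
    proof -
      \<comment> \<open>The interfaces cover \<open>chans T\<close> and \<open>outs T\<close>, so
        the restricted labels reassemble to the full one.\<close>
      have "lab ?A (?h t) = (fst (lab T t) \<inter> chans T, snd (lab T t) \<inter> outs T)"
        using ls_lab_par_list[OF ne h[OF t]] loc t
        by (simp add: follows_locally_def chans outs sets)
      moreover have "fst (lab T t) \<subseteq> chans T" "snd (lab T t) \<subseteq> outs T"
        using T(1) t by (auto simp: transition_system_def)
      ultimately show ?thesis
        by (simp add: inf.absorb1)
    qed
    have wf: "s' \<in> states T" "c \<in> ls T s" "c \<in> chans T" "c \<in> fst (lab T s')"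
      if "(s, c, s') \<in> trn T" for c s'
      using transition_system_trnD[OF T(1) that] T(2) that
      by (auto simp: communication_closed_def)
    have step: "(\<forall>i<length Ts. local_step (Ts ! i) c (?h s ! i) (a ! i)) \<longleftrightarrow> a = ?h s'"
      if "(s, c, s') \<in> trn T" "length a = length Ts" for c s' a
    proof -
      have "local_step (Ts ! i) c (?h s ! i) (a ! i) \<longleftrightarrow> a ! i = ?h s' ! i"
        if "i < length Ts" for i
        using loc[OF that] s \<open>(s, c, s') \<in> trn T\<close> that by (simp add: follows_locally_def)
      then have "(\<forall>i<length Ts. local_step (Ts ! i) c (?h s ! i) (a ! i)) \<longleftrightarrow>
          (\<forall>i<length Ts. a ! i = ?h s' ! i)"
        by (simp only: cong: imp_cong)
      also have "\<dots> \<longleftrightarrow> a = ?h s'"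
        using that(2) by (auto intro: nth_equalityI)
      finally show ?thesis .
    qed
    have "initiates ?A (?h s) c a \<longleftrightarrow> (\<exists>s'. (s, c, s') \<in> trn T \<and> a = ?h s')" for c a
    proof
      assume "initiates ?A (?h s) c a"
      then have c: "c \<in> chans ?A" and tr: "(?h s, c, a) \<in> trn ?A"
        by (auto simp: initiates_def)
      then obtain i where "i < length Ts" "c \<in> ls (Ts ! i) (?h s ! i)" "c \<in> chans (Ts ! i)"
        and len: "length a = length Ts"
        and all: "\<forall>i<length Ts. local_step (Ts ! i) c (?h s ! i) (a ! i)"
        using trn_par_list[OF ne disj lt] states_par_list[OF ne] by blast
      then have "c \<in> ls T s"
        using loc[of i] s by (auto simp: follows_locally_def)
      then obtain s' where "(s, c, s') \<in> trn T"
        using transition_system_lsE[OF T(1) s] by blast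
      then show "\<exists>s'. (s, c, s') \<in> trn T \<and> a = ?h s'"
        using step len all by blast
    next
      assume "\<exists>s'. (s, c, s') \<in> trn T \<and> a = ?h s'"
      then obtain s' where tr: "(s, c, s') \<in> trn T" and a: "a = ?h s'" by blast
      obtain i where i: "i < length Ts" "c \<in> chans (Ts ! i)"
        using wf(3)[OF tr] by (auto simp: chans sets)
      then have "c \<in> ls (Ts ! i) (?h s ! i)"
        using loc[OF i(1)] wf(2)[OF tr] s by (auto simp: follows_locally_def)
      moreover have "\<forall>i<length Ts. local_step (Ts ! i) c (?h s ! i) (a ! i)"
        using step[OF tr, of a] a by simp
      ultimately have "(?h s, c, a) \<in> trn ?A"
        using trn_par_list[OF ne disj lt] h[OF s] h[OF wf(1)[OF tr]] i a by blast
      \<comment> \<open>The demand on the target label in \<open>initiates\<close> is axiom (ii) of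
        \<open>T\<close>, transported by the equality of labels.\<close>
      then show "initiates ?A (?h s) c a"
        using wf[OF tr] lab a by (simp add: initiates_def chA)
    qed
    then show ?thesis using h lab s by blast
  qed
  ultimately show ?thesis
    using chA by (simp add: follows_def)
qed

text \<open>The trivial component keeps the whole of \<open>ls\<close> and \<open>trn\<close>, so it
  listens to every step of \<open>T\<close>; determinism makes its successor the only one.\<close>

lemma component_follows_locally:
  assumes T: "transition_system T" and det: "deterministic T"
  shows "follows_locally T (component T Y Out k) (\<lambda>s. s)"
proof -
  note wf = transition_system_trnD[OF T]
  have "s' = s''" if "(s, c, s') \<in> trn T" "(s, c, s'') \<in> trn T" for s c s' s''
    using det wf that by (auto simp: deterministic_def succs_def)
  with wf show ?thesis
    by (auto simp: follows_locally_def component_def restrict_interface_def local_step_def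
        listens_to_transitions_def)
qed


section \<open>Compression\<close>

text \<open>A split must not create an empty block. \<open>s1\<close> lies in the first half;
  \<open>s2\<close> lies in the second because its only \<open>c\<close>-successor is in
  \<open>B''\<close>, which is disjoint from \<open>B'\<close>. This is where determinism
  enters.\<close>

lemma split_step_partition:
  assumes "split_step T P P'" and "partition_on (states T) P" and "deterministic T"
  shows "partition_on (states T) P'" and "\<forall>B'\<in>P'. \<exists>B\<in>P. B' \<subseteq> B"
proof -
  obtain B B' B'' s1 s2 s1' s2' c where *: "B \<in> P" "B' \<in> P" "B'' \<in> P" "s1 \<in> B" "s2 \<in> B"
    "s1' \<in> B'" "s2' \<in> B''" "B' \<noteq> B''" "(s1, c, s1') \<in> trn T" "(s2, c, s2') \<in> trn T"
    and P': "P' = (P - {B}) \<union>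
      {{s\<in>B. \<exists>t\<in>B'. (s, c, t) \<in> trn T}, {s\<in>B. \<not> (\<exists>t\<in>B'. (s, c, t) \<in> trn T)}}"
    using assms(1) unfolding split_step_def by blast
  let ?U = "{s\<in>B. \<exists>t\<in>B'. (s, c, t) \<in> trn T}" and ?V = "{s\<in>B. \<not> (\<exists>t\<in>B'. (s, c, t) \<in> trn T)}"
  have disj: "X \<in> P \<Longrightarrow> Z \<in> P \<Longrightarrow> X \<noteq> Z \<Longrightarrow> X \<inter> Z = {}" for X Z
    using assms(2) by (auto simp: partition_on_def disjoint_def)
  have "s2 \<in> states T"
    using assms(2) * by (auto simp: partition_on_def)
  then have "t = s2'" if "(s2, c, t) \<in> trn T" for t
    using assms(3) *(10) that by (auto simp: deterministic_def succs_def)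
  then have "s2 \<in> ?V"
    using disj[OF *(2,3,8)] * by blast
  moreover have "s1 \<in> ?U"
    using * by blast
  moreover have "\<Union>P' = \<Union>P"
    using *(1) unfolding P' by blast
  moreover have "disjoint P'"
  proof (rule disjointI)
    fix X Z
    assume "X \<in> P'" "Z \<in> P'" "X \<noteq> Z"
    then consider "X \<in> P" "Z \<in> P" | "X \<in> P" "X \<noteq> B" "Z \<subseteq> B" | "X \<subseteq> B" "Z \<in> P" "Z \<noteq> B"
      | "X = ?U" "Z = ?V" | "X = ?V" "Z = ?U"
      unfolding P' by blast
    then show "X \<inter> Z = {}"
      by cases (use disj[of X Z] disj[of X B] disj[of B Z] *(1) \<open>X \<noteq> Z\<close> in blast)+
  qed
  ultimately show "partition_on (states T) P'"
    using assms(2) by (auto simp: partition_on_def P')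
  show "\<forall>B'\<in>P'. \<exists>B\<in>P. B' \<subseteq> B"
    unfolding P' using *(1) by blast
qed

text \<open>Splitting only shrinks blocks, and subsets of cliques are cliques, so both properties
  survive every refinement step.\<close>

lemma compression_partition_blocks:
  assumes "compression_partition T E P" and "deterministic T"
  shows "partition_on (states T) P \<and> (\<forall>B\<in>P. merge_clique T E B)"
proof -
  obtain Q where Q: "maximal_clique_partition T E Q" "(split_step T)\<^sup>*\<^sup>* Q P"
    using assms(1) by (auto simp: compression_partition_def)
  from Q(2) show ?thesis
  proof (induction rule: rtranclp_induct)
    case base
    then show ?case
      using Q(1) by (simp add: maximal_clique_partition_def)
  next
    case (step P1 P2)
    have "merge_clique T E B'" if "merge_clique T E B" "B' \<subseteq> B" for B B'
      using that unfolding merge_clique_def by blast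
    then show ?case
      using step split_step_partition[OF step(2) _ assms(2)] by blast
  qed
qed

text \<open>Two different target blocks would license another split, contradicting termination of
  the refinement.\<close>

lemma compression_partition_stable:
  assumes "compression_partition T E P"
    and "B \<in> P" "B' \<in> P" "B'' \<in> P" "s1 \<in> B" "s2 \<in> B" "s1' \<in> B'" "s2' \<in> B''"
    and "(s1, c, s1') \<in> trn T" "(s2, c, s2') \<in> trn T"
  shows "B' = B''"
proof (rule ccontr)
  assume "B' \<noteq> B''"
  with assms have "\<exists>P'. split_step T P P'"
    unfolding split_step_def by blast
  with assms(1) show False
    by (simp add: compression_partition_def)
qed

section \<open>Consequences of reconfigurable bisimilarity inside a block\<close>

lemma reconfigurable_simulationD:
  assumes "reconfigurable_simulation A E R" "\<epsilon> \<in> states E" "(s, t) \<in> R \<epsilon>"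
  shows "lab A s = lab A t"
    and "(\<epsilon>, c, \<epsilon>') \<in> trn E \<Longrightarrow> initiates A s c s' \<Longrightarrow> \<exists>t'. initiates A t c t'"
proof -
  note * = bspec[OF bspec[OF assms(1)[unfolded reconfigurable_simulation_def] assms(2)] assms(3),
      unfolded prod.case]
  then show "lab A s = lab A t" by (rule conjunct1)
  assume "(\<epsilon>, c, \<epsilon>') \<in> trn E" "initiates A s c s'"
  moreover from this have "c \<in> chans A \<union> chans E"
    by (simp add: initiates_def)
  \<comment> \<open>Clause (2.2)(a). Only enabledness is kept; stability of the partition will
    locate the targets.\<close>
  ultimately show "\<exists>t'. initiates A t c t'"
    using conjunct2[OF *, rule_format, of c] by blast
qed

lemma merge_cliqueE:
  assumes "merge_clique A E B" "s \<in> B" "t \<in> B" "s \<noteq> t"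
  obtains R where "reconfigurable_simulation A E R" "(s, t) \<in> R (Copy s)" "s \<in> states A"
  using assms
  unfolding merge_clique_def mergeable_def bisim_class_def reconfigurably_bisimilar_def
    reconfigurable_bisimulation_def
  by blast

lemma merge_clique_lab:
  assumes "merge_clique A E B" "s \<in> B" "t \<in> B" "states E = Copy ` states A"
  shows "lab A s = lab A t"
proof (cases "s = t")
  case False
  with assms obtain R where R: "reconfigurable_simulation A E R" "(s, t) \<in> R (Copy s)"
    and "s \<in> states A"
    by (blast elim: merge_cliqueE)
  then have "Copy s \<in> states E"
    using assms by simp
  with R show ?thesis
    by (blast dest: reconfigurable_simulationD(1))
qed simp

text \<open>Members of a clique are compared at index \<open>Copy s\<close>, with the parameter in
  the same state as the component. The parameter then makes the same \<open>c\<close>-move, so the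
  clause for a moving parameter applies.\<close>

lemma merge_clique_initiates:
  assumes "merge_clique A E B" "s \<in> B" "t \<in> B" "states E = Copy ` states A"
    and "(Copy s, c, Copy s') \<in> trn E" "initiates A s c s'"
  shows "\<exists>t'. initiates A t c t'"
proof (cases "s = t")
  case True
  with assms(6) show ?thesis by blast
next
  case False
  with assms obtain R where R: "reconfigurable_simulation A E R" "(s, t) \<in> R (Copy s)"
    and "s \<in> states A"
    by (blast elim: merge_cliqueE)
  then have "Copy s \<in> states E"
    using assms by simp
  with R show ?thesis
    using reconfigurable_simulationD(2) assms(5,6) by metis
qed

section \<open>The compressed component follows the system locally\<close>

definition block :: "'s set set \<Rightarrow> 's \<Rightarrow> 's set" where
  "block P s = (THE B. B \<in> P \<and> s \<in> B)"

lemma block_eqI: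
  assumes "partition_on S P" "B \<in> P" "s \<in> B"
  shows "block P s = B"
  unfolding block_def
  using assms by (intro the_equality) (auto simp: partition_on_def disjoint_def)

text \<open>Uniqueness of target blocks comes from stability, enabledness on \<open>Y k\<close> from
  bisimilarity. Hence compression discards only steps inside a block on channels outside
  \<open>Y k\<close>, and these leave \<open>block P\<close> unchanged.\<close>

lemma compressed_follows_locally:
  assumes T: "transition_system T" and det: "deterministic T"
    and Yk: "Y k \<subseteq> chans T"
    and P: "compression_partition (component T Y Out k) (parameter T n Y Out k) P"
  shows "follows_locally T (compressed (component T Y Out k) P) (block P)"
proof -
  let ?A = "component T Y Out k" and ?E = "parameter T n Y Out k"
  let ?C = "compressed ?A P"
  note A = component_def restrict_interface_def
  have A_sel: "states ?A = states T" "trn ?A = trn T" "chans ?A = Y k" "start ?A = start T"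
    "lab ?A s = (fst (lab T s) \<inter> Y k, snd (lab T s) \<inter> Out k)" "outs ?A = Out k" for s
    by (simp_all add: A)
  \<comment> \<open>The parameter carries all of \<open>trn T\<close>, so it mirrors each step at
    the copies.\<close>
  have E: "states ?E = Copy ` states ?A"
    "(s, c, s') \<in> trn T \<Longrightarrow> (Copy s, c, Copy s') \<in> trn ?E" for s c s'
    by (auto simp: parameter_def rename_def A)
  \<comment> \<open>\<open>block\<close> uses the same description as the initial state of
    \<open>compressed\<close>, hence the start equation.\<close>
  have C: "states ?C = P" "trn ?C = compressed_trn ?A P" "chans ?C = Y k" "outs ?C = Out k"
    "start ?C = block P (start T)" "\<And>B. ls ?C B = {c. \<exists>B'. (B, c, B') \<in> trn ?C}"
    "\<And>B. lab ?C B = lab ?A (SOME s. s \<in> B)"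
    by (simp_all add: compressed_def block_def A_sel)
  have "deterministic ?A"
    using det by (simp add: deterministic_def succs_def A)
  then have part: "partition_on (states T) P" and clique: "\<And>B. B \<in> P \<Longrightarrow> merge_clique ?A ?E B"
    using compression_partition_blocks[OF P] by (auto simp: A_sel)
  have blk: "block P s \<in> P" "s \<in> block P s" if "s \<in> states T" for s
  proof -
    obtain B where "B \<in> P" "s \<in> B"
      using part \<open>s \<in> states T\<close> unfolding partition_on_def by blast
    then show "block P s \<in> P" "s \<in> block P s"
      using block_eqI[OF part] by auto
  qed
  note blkI = block_eqI[OF part]
  note wf = transition_system_trnD[OF T]
  have stable: "block P s' = block P t'"
    if "(s, c, s') \<in> trn T" "(t, c, t') \<in> trn T" "block P s = block P t" for s s' t t' c
    by (rule compression_partition_stable[OF P, of "block P s" _ _ s t s' t' c])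
      (use that wf blk A_sel in metis)+
  \<comment> \<open>Axiom (ii) puts \<open>c\<close> into the label of the target, so a step of
    \<open>T\<close> on \<open>Y k\<close> is initiated in the component, and bisimilarity transfers
    it to the whole block.\<close>
  have initiates: "\<exists>t'. (t, c, t') \<in> trn T"
    if "(s, c, s') \<in> trn T" "c \<in> Y k" "t \<in> states T" "block P s = block P t" for s s' t c
  proof -
    have "initiates ?A s c s'"
      using that wf(4)[OF that(1)] Yk by (auto simp: initiates_def A_sel)
    moreover have "block P s \<in> P" "s \<in> block P s" "t \<in> block P s"
      using that wf(1) blk by metis+
    ultimately have "\<exists>t'. initiates ?A t c t'"
      using merge_clique_initiates[OF clique _ _ E(1) E(2)[OF that(1)]] by blast
    then show ?thesis
      by (auto simp: initiates_def A_sel)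
  qed
  \<comment> \<open>A self-loop is defined by a universal condition over the block; nonemptiness of
    blocks turns it into a concrete step of \<open>T\<close>.\<close>
  have trnD: "\<exists>s s'. (s, c, s') \<in> trn T \<and> block P s = B \<and> block P s' = B'"
    if "(B, c, B') \<in> trn ?C" for B c B'
  proof -
    have "B \<in> P" "B' \<in> P" "\<exists>s\<in>B. \<exists>s'\<in>B'. (s, c, s') \<in> trn T"
      using that part
      by (auto simp: C compressed_trn_def A_sel partition_on_def) (metis ex_in_conv)
    then show ?thesis
      using blkI by blast
  qed
  have trnI: "(block P s, c, block P s') \<in> trn ?C"
    if "(s, c, s') \<in> trn T" "block P s \<noteq> block P s' \<or> c \<in> Y k" for s c s'
  proof (cases "block P s = block P s'")
    case False
    have mem: "block P s \<in> P" "s \<in> block P s" "block P s' \<in> P" "s' \<in> block P s'"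
      using wf(1,2)[OF that(1)] blk by simp_all
    then have "\<exists>t\<in>block P s. \<exists>t'\<in>block P s'. (t, c, t') \<in> trn T"
      using that(1) by blast
    with False mem(1,3) show ?thesis
      by (simp add: C(2) compressed_trn_def A_sel)
  next
    case True
    \<comment> \<open>The self-loop needs every member to step back into the block: bisimilarity
      yields a step, stability its target.\<close>
    have "\<exists>t'\<in>block P s. (t, c, t') \<in> trn T" if "t \<in> block P s" for t
    proof -
      have bt: "block P t = block P s" and t: "t \<in> states T"
        using that blk(1)[OF wf(1)[OF \<open>(s, c, s') \<in> trn T\<close>]] blkI part
        by (blast, auto simp: partition_on_def)
      then obtain t' where t': "(t, c, t') \<in> trn T"
        using initiates[OF \<open>(s, c, s') \<in> trn T\<close>] True \<open>_ \<or> c \<in> Y k\<close> by metis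
      then have "block P t' = block P s"
        using stable[OF \<open>(s, c, s') \<in> trn T\<close> t'] bt True by simp
      then show ?thesis
        using t' wf(2) blk(2) by blast
    qed
    then show ?thesis
      using that True blk(1)[OF wf(1)[OF that(1)]] by (simp add: C(2) compressed_trn_def A_sel)
  qed
  have step: "local_step ?C c (block P s) B \<longleftrightarrow> B = block P s'"
    if s: "(s, c, s') \<in> trn T" for s c s' B
  proof -
    have succ: "B' = block P s'" if "(block P s, c, B') \<in> trn ?C" for B'
      using trnD[OF that] stable[OF s] by metis
    show ?thesis
    proof (cases "c \<in> ls ?C (block P s)")
      case True
      then show ?thesis
        using succ by (auto simp: local_step_def C(6))
    next
      case False
      \<comment> \<open>A deaf block has no \<open>c\<close>-transition, so by \<open>trnI\<close>
        the step of \<open>T\<close> stays inside the block and idling is correct.\<close>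
      then have "block P s = block P s'"
        using trnI[OF s] by (auto simp: C(6))
      with False show ?thesis
        by (simp add: local_step_def)
    qed
  qed
  \<comment> \<open>A block may listen because of a single member; for \<open>c\<close> in
    \<open>Y k\<close> bisimilarity carries this to every member \<open>s\<close>.\<close>
  have ls: "c \<in> ls ?C (block P s) \<longleftrightarrow> c \<in> ls T s" if s: "s \<in> states T" and c: "c \<in> Y k" for s c
  proof
    assume "c \<in> ls ?C (block P s)"
    then obtain B' where "(block P s, c, B') \<in> trn ?C"
      by (auto simp: C(6))
    then obtain t t' where "(t, c, t') \<in> trn T" "block P t = block P s"
      using trnD by blast
    then show "c \<in> ls T s"
      using initiates c s wf(3) by blast
  next
    assume "c \<in> ls T s"
    then obtain s' where "(s, c, s') \<in> trn T"
      using transition_system_lsE[OF T s] by blast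
    then show "c \<in> ls ?C (block P s)"
      using trnI c by (auto simp: C(6))
  qed
  have lab: "lab ?C (block P s) = (fst (lab T s) \<inter> Y k, snd (lab T s) \<inter> Out k)"
    if s: "s \<in> states T" for s
  proof -
    have "(SOME t. t \<in> block P s) \<in> block P s"
      using blk(2)[OF s] by (rule someI)
    then have "lab ?A (SOME t. t \<in> block P s) = lab ?A s"
      using merge_clique_lab[OF clique _ _ E(1)] blk[OF s] by blast
    then show ?thesis
      by (simp add: C(7) A_sel)
  qed
  have "listens_to_transitions ?C"
    by (auto simp: listens_to_transitions_def C compressed_trn_def)
  with step ls lab blk show ?thesis
    by (simp add: follows_locally_def C(1,3,4,5))
qed

section \<open>Instantiation for both compositions\<close>

theorem theorem5p7:
  fixes T :: "('s, 'c, 'o) ts"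
    and n :: nat
    and Y :: "nat \<Rightarrow> 'c set"
    and Out :: "nat \<Rightarrow> 'o set"
    and P :: "nat \<Rightarrow> 's set set"
  assumes "n \<ge> 2"
    and "transition_system T"
    and "deterministic T"
    and "communication_closed T"
    and "chans T = (\<Union>k\<in>{1..n}. Y k)"
    and "outs T = (\<Union>k\<in>{1..n}. Out k)"
    and "\<forall>j\<in>{1..n}. \<forall>k\<in>{1..n}. j \<noteq> k \<longrightarrow> Y j \<inter> Y k = {} \<and> Out j \<inter> Out k = {}"
    and "\<forall>k\<in>{1..n}. compression_partition (component T Y Out k) (parameter T n Y Out k) (P k)"
  shows "initiated_bisimilar
           (par_list (map (component T Y Out) [1..<n + 1]))
           (par_list (map (\<lambda>k. compressed (component T Y Out k) (P k)) [1..<n + 1]))"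
proof -
  \<comment> \<open>Proved once for an arbitrary state type \<open>'a\<close>, to serve states of
    \<open>T\<close> and blocks alike. List positions start at 0 and component indices at 1, whence
    \<open>Suc i\<close>.\<close>
  have follows: "follows T (par_list (map A [1..<n + 1])) (\<lambda>s. map (\<lambda>i. f i s) [0..<n])"
    if ch: "\<And>k. chans (A k) = Y k \<and> outs (A k) = Out k"
      and loc: "\<And>i. i < n \<Longrightarrow> follows_locally T (A (Suc i)) (f i)"
    for A :: "nat \<Rightarrow> ('a, 'c, 'o) ts" and f
  proof -
    let ?Ts = "map A [1..<n + 1]"
    have set: "set ?Ts = A ` {1..n}" and nth: "i < n \<Longrightarrow> ?Ts ! i = A (Suc i)" for i
      by (auto simp del: upt_Suc)
    have "?Ts \<noteq> []"
      using assms(1) by simp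
    moreover have "disjoint_chans ?Ts"
      using assms(7) ch by (auto simp: disjoint_chans_def simp del: upt_Suc)
    moreover have "chans T = (\<Union>A\<in>set ?Ts. chans A)" "outs T = (\<Union>A\<in>set ?Ts. outs A)"
      using assms(5,6) ch unfolding set by auto
    ultimately show ?thesis
      using par_list_follows[OF assms(2,4), of ?Ts f] loc nth by (simp del: upt_Suc)
  qed
  have "follows T (par_list (map (component T Y Out) [1..<n + 1])) (\<lambda>s. map (\<lambda>i. s) [0..<n])"
    by (rule follows[of "component T Y Out" "\<lambda>i s. s"])
      (simp add: component_def restrict_interface_def,
       rule component_follows_locally[OF assms(2,3)])
  moreover have "follows T
      (par_list (map (\<lambda>k. compressed (component T Y Out k) (P k)) [1..<n + 1]))
      (\<lambda>s. map (\<lambda>i. block (P (Suc i)) s) [0..<n])"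
  proof (rule follows)
    show "follows_locally T (compressed (component T Y Out (Suc i)) (P (Suc i))) (block (P (Suc i)))"
      if "i < n" for i
    proof -
      have "Suc i \<in> {1..n}" using that by simp
      then show ?thesis
        using compressed_follows_locally[OF assms(2,3)] assms(5,8) by blast
    qed
  qed (simp add: compressed_def component_def restrict_interface_def)
  ultimately show ?thesis
    using assms(2) by (rule initiated_bisimilar_if_follow)
qed

end
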